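(* Let $z_{k-1}\ne z_k$ in $\mathbb{R}^{n+1}$, $s_{k-1}=z_k-z_{k-1}$, let $b_k\in\mathbb{R}^{n+1}$ be nonzero, $\vartheta>1$, $g_k=\nabla\Phi_\tau(z_k)$, and let $\mu_k^\star$, $\Gamma_0$ and $d_k$ be as defined in the context. Then every choice $0\le\mu_k\le\mu_k^\star$ satisfies $$d_k^TP_kd_k\le\Gamma_0\,g_k^TP_k^{-1}g_k.$$ In particular one may take $\mu_k=\xi_k\mu_k^\star$ with $0\le\xi_k\le1$.
   Context: Let $f_1,\dots,f_m\in C^1(\mathbb{R}^n)$ have gradients that are Lipschitz on $\mathbb{R}^n$ with constants $L_i\ge0$; $\bar L=\sum_i L_i$; $\tau>0$, $\delta>0$. Let $\phi_\tau(r)=\frac{r+\sqrt{r^2+\tau^2}}{2}$ and $\Phi_\tau(x,t)=t+\sum_{i=1}^m\phi_\tau(f_i(x)-t)$ on $\mathbb{R}^{n+1}$. At $z_k=(x_k,t_k)$ let $\omega_{i,k}=\sqrt{(f_i(x_k)-t_k)^2+\tau^2}$, $J_k$ the $m\times(n+1)$ matrix with rows $(\nabla f_i(x_k)^T,-1)$, $D_k=\operatorname{diag}(\omega_{1,k}^{-1},\dots,\omega_{m,k}^{-1})$, $\Pi_x=\operatorname{diag}(I_n,0)$, and $P_k=\delta I_{n+1}+\bar L\Pi_x+\frac12J_k^TD_kJ_k$, a symmetric positive definite matrix. Put $C_k=s_{k-1}^TP_ks_{k-1}$, $B_k=b_k^TP_k^{-1}b_k$, $\Delta_k=s_{k-1}^Tb_k$,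 $\chi_k=\Delta_k/\sqrt{C_kB_k}\in[-1,1]$, $\mathcal{D}_k=\Delta_k+\vartheta\sqrt{C_kB_k}$ (positive), $\varpi_k^2=\frac{1-\chi_k^2}{(\vartheta+\chi_k)^2}$, $\Gamma_0=\frac{\vartheta^2}{\vartheta^2-1}$, $\mu_k^\star=\frac{\Gamma_0-1-\varpi_k^2}{\sqrt{\Gamma_0}+1}$. For $\mu_k\ge0$ the enhanced direction is $$d_k=-P_k^{-1}g_k+\left[\frac{g_k^TP_k^{-1}b_k}{\mathcal{D}_k}-\mu_k\frac{g_k^Ts_{k-1}}{C_k}\right]s_{k-1}-\frac{g_k^Ts_{k-1}}{\mathcal{D}_k}P_k^{-1}b_k.$$ *)

theory Defs
  imports "HOL-Analysis.Analysis"
begin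

definition gradient :: "('a::real_inner \<Rightarrow> real) \<Rightarrow> 'a \<Rightarrow> 'a" where
  "gradient f x = (THE D. GDERIV f x :> D)"

lemma gradient_eqI: "GDERIV f x :> D \<Longrightarrow> gradient f x = D"
proof -
  assume D: "GDERIV f x :> D"
  have "D' = D" if "GDERIV f x :> D'" for D'
  proof -
    have "(\<lambda>h. h \<bullet> D') = (\<lambda>h. h \<bullet> D)"
      using has_derivative_unique[OF that[unfolded gderiv_def] D[unfolded gderiv_def]] .
    then have "\<And>h. h \<bullet> D' = h \<bullet> D" by meson
    then show ?thesis using vector_eq_ldot by blast
  qed
  with D show ?thesis unfolding gradient_def by blast
qed

text \<open>The index type \<open>'n option\<close> has one element more than \<open>'n\<close>, so
  \<open>real ^ 'n option\<close> is the space of points \<open>z = (x, t)\<close> with \<open>x\<close> in \<open>real ^ 'n\<close> and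
  \<open>t\<close> real: the coordinates \<open>Some j\<close> are those of \<open>x\<close>, the coordinate \<open>None\<close> is \<open>t\<close>.\<close>

definition xpart :: "real ^ ('n::finite) option \<Rightarrow> real ^ 'n" where
  "xpart z = (\<chi> j. z $ Some j)"

definition tpart :: "real ^ ('n::finite) option \<Rightarrow> real" where
  "tpart z = z $ None"

definition diag_mat :: "real ^ 'k \<Rightarrow> real ^ 'k ^ 'k" where
  "diag_mat v = (\<chi> i j. if i = j then v $ i else 0)"

definition phi :: "real \<Rightarrow> real \<Rightarrow> real" where
  "phi \<tau> r = (r + sqrt (r\<^sup>2 + \<tau>\<^sup>2)) / 2"

definition Phi :: "real \<Rightarrow> ('m::finite \<Rightarrow> real ^ 'n \<Rightarrow> real) \<Rightarrow> real ^ ('n::finite) option \<Rightarrow> real" where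
  "Phi \<tau> f z = tpart z + (\<Sum>i\<in>UNIV. phi \<tau> (f i (xpart z) - tpart z))"

definition omega ::
  "real \<Rightarrow> ('m \<Rightarrow> real ^ 'n \<Rightarrow> real) \<Rightarrow> real ^ ('n::finite) option \<Rightarrow> 'm \<Rightarrow> real" where
  "omega \<tau> f z i = sqrt ((f i (xpart z) - tpart z)\<^sup>2 + \<tau>\<^sup>2)"

definition J_mat ::
  "('m \<Rightarrow> real ^ 'n \<Rightarrow> real) \<Rightarrow> real ^ ('n::finite) option \<Rightarrow> real ^ ('n::finite) option ^ 'm" where
  "J_mat f z = (\<chi> i j. case j of Some l \<Rightarrow> gradient (f i) (xpart z) $ l | None \<Rightarrow> - 1)"

definition D_mat ::
  "real \<Rightarrow> ('m \<Rightarrow> real ^ 'n \<Rightarrow> real) \<Rightarrow> real ^ ('n::finite) option \<Rightarrow> real ^ 'm ^ 'm" where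
  "D_mat \<tau> f z = diag_mat (\<chi> i. inverse (omega \<tau> f z i))"

definition Pi_x :: "real ^ ('n::finite) option ^ ('n::finite) option" where
  "Pi_x = diag_mat (\<chi> j. case j of Some l \<Rightarrow> 1 | None \<Rightarrow> 0)"

definition P_mat ::
  "real \<Rightarrow> real \<Rightarrow> ('m::finite \<Rightarrow> real) \<Rightarrow> ('m \<Rightarrow> real ^ 'n \<Rightarrow> real) \<Rightarrow> real ^ ('n::finite) option
    \<Rightarrow> real ^ ('n::finite) option ^ ('n::finite) option" where
  "P_mat \<tau> \<delta> L f z =
     \<delta> *\<^sub>R mat 1 + (\<Sum>i\<in>UNIV. L i) *\<^sub>R Pi_x
     + (1/2) *\<^sub>R (transpose (J_mat f z) ** D_mat \<tau> f z ** J_mat f z)"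

text \<open>In the following, \<open>P\<close>, \<open>s\<close>, \<open>b\<close>, \<open>g\<close> and \<open>\<theta>\<close> stand for \<open>P\<^sub>k\<close>, the previous step
  \<open>z\<^sub>k - z\<^sub>k\<^sub>-\<^sub>1\<close>, \<open>b\<^sub>k\<close>, \<open>g\<^sub>k\<close> and \<open>\<vartheta>\<close>; \<open>den\<close> is the calligraphic \<open>D\<^sub>k\<close>.\<close>

definition C_val :: "real ^ 'k ^ 'k \<Rightarrow> real ^ 'k \<Rightarrow> real" where
  "C_val P s = s \<bullet> (P *v s)"

definition B_val :: "real ^ 'k ^ 'k \<Rightarrow> real ^ 'k \<Rightarrow> real" where
  "B_val P b = b \<bullet> (matrix_inv P *v b)"

definition chi :: "real ^ 'k ^ 'k \<Rightarrow> real ^ 'k \<Rightarrow> real ^ 'k \<Rightarrow> real" where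
  "chi P s b = (s \<bullet> b) / sqrt (C_val P s * B_val P b)"

definition den :: "real \<Rightarrow> real ^ 'k ^ 'k \<Rightarrow> real ^ 'k \<Rightarrow> real ^ 'k \<Rightarrow> real" where
  "den \<theta> P s b = s \<bullet> b + \<theta> * sqrt (C_val P s * B_val P b)"

definition varpi_sq :: "real \<Rightarrow> real ^ 'k ^ 'k \<Rightarrow> real ^ 'k \<Rightarrow> real ^ 'k \<Rightarrow> real" where
  "varpi_sq \<theta> P s b = (1 - (chi P s b)\<^sup>2) / (\<theta> + chi P s b)\<^sup>2"

definition Gamma0 :: "real \<Rightarrow> real" where
  "Gamma0 \<theta> = \<theta>\<^sup>2 / (\<theta>\<^sup>2 - 1)"

definition mu_star :: "real \<Rightarrow> real ^ 'k ^ 'k \<Rightarrow> real ^ 'k \<Rightarrow> real ^ 'k \<Rightarrow> real" where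
  "mu_star \<theta> P s b = (Gamma0 \<theta> - 1 - varpi_sq \<theta> P s b) / (sqrt (Gamma0 \<theta>) + 1)"

definition enhanced_dir ::
  "real \<Rightarrow> real ^ 'k ^ 'k \<Rightarrow> real ^ 'k \<Rightarrow> real ^ 'k \<Rightarrow> real ^ 'k \<Rightarrow> real \<Rightarrow> real ^ 'k" where
  "enhanced_dir \<theta> P s b g \<mu> =
     - (matrix_inv P *v g)
     + ((g \<bullet> (matrix_inv P *v b)) / den \<theta> P s b - \<mu> * ((g \<bullet> s) / C_val P s)) *\<^sub>R s
     - ((g \<bullet> s) / den \<theta> P s b) *\<^sub>R (matrix_inv P *v b)"

end

theory Submission
  imports Defs
begin

text \<open>
  The bound is a statement about the operator norm of a perturbation of the identity of rank at
  most two. The matrix \<open>P\<close> is symmetric positive definite; measure everything in the inner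
  product \<open>\<langle>u, v\<rangle> = u\<^sup>T P v\<close> and put
  \<open>p = P\<^sup>-\<^sup>1 g\<close>, so that \<open>g\<^sup>T P\<^sup>-\<^sup>1 g = \<langle>p, p\<rangle>\<close>. With \<open>\<sigma>\<close> and \<open>\<beta>\<close> the normalisations of
  \<open>s\<close> and \<open>P\<^sup>-\<^sup>1 b\<close>, one has \<open>\<chi> = \<langle>\<sigma>, \<beta>\<rangle>\<close>, and the direction is
  \<open>d = - (I + A + \<mu> \<sigma> \<sigma>\<^sup>*) p\<close>, where \<open>A p = (\<langle>p, \<sigma>\<rangle> \<beta> - \<langle>p, \<beta>\<rangle> \<sigma>) / (\<theta> + \<chi>)\<close> is skew and
  supported on the plane of \<open>\<sigma>\<close> and \<open>\<beta>\<close>. In an orthonormal basis \<open>\<sigma>, \<eta>\<close> of that plane,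
  \<open>A\<close> is \<open>w\<close> times a quarter turn, with \<open>w\<^sup>2 = (1 - \<chi>\<^sup>2) / (\<theta> + \<chi>)\<^sup>2\<close>. So the map acts there
  as the matrix with rows \<open>(1 + \<mu>, -w)\<close> and \<open>(w, 1)\<close>, and as the identity on the orthogonal
  complement.

  It remains to see that this \<open>2 \<times> 2\<close> matrix \<open>M\<close> has squared norm at most \<open>\<Gamma> = \<Gamma>\<^sub>0\<close>. Put
  \<open>E = \<Gamma> - 1 - w\<^sup>2\<close>; it is nonnegative because
  \<open>(\<theta> + \<chi>)\<^sup>2 - (\<theta>\<^sup>2 - 1) (1 - \<chi>\<^sup>2) = (1 + \<theta> \<chi>)\<^sup>2\<close>. The determinant of \<open>\<Gamma> I - M\<^sup>T M\<close> is
  \<open>E\<^sup>2 - 2 \<mu> E - \<mu>\<^sup>2 (\<Gamma> - 1)\<close>, which decreases in \<open>\<mu> \<ge> 0\<close> and vanishes exactly at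
  \<open>\<mu> = E / (\<surd>\<Gamma> + 1)\<close>. This is the bound imposed on \<open>\<mu>\<close>; estimating the norm of \<open>M\<close> by the
  triangle inequality would only allow the in general smaller value \<open>\<surd>\<Gamma> - \<surd>(1 + w\<^sup>2)\<close>.
  The determinant computation is \<open>shifted_rotation_form_nonneg\<close>, the reduction to the plane is
  \<open>unit_direction_bound\<close>, and \<open>enhanced_dir_normalised\<close> connects them to the direction.
\<close>

section \<open>Positive definite matrices as inner products\<close>

definition ip :: "real ^ 'k ^ 'k \<Rightarrow> real ^ 'k \<Rightarrow> real ^ 'k \<Rightarrow> real" where
  "ip P u v = u \<bullet> (P *v v)"

definition pos_def :: "real ^ 'k ^ 'k \<Rightarrow> bool" where
  "pos_def P \<longleftrightarrow> (\<forall>x y. ip P x y = ip P y x) \<and> (\<forall>x. x \<noteq> 0 \<longrightarrow> ip P x x > 0)"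

lemma ip_linear:
  "ip P (u + v) w = ip P u w + ip P v w"
  "ip P (u - v) w = ip P u w - ip P v w"
  "ip P (- u) w = - ip P u w"
  "ip P (c *\<^sub>R u) w = c * ip P u w"
  "ip P w (u + v) = ip P w u + ip P w v"
  "ip P w (u - v) = ip P w u - ip P w v"
  "ip P w (- u) = - ip P w u"
  "ip P w (c *\<^sub>R u) = c * ip P w u"
proof -
  have neg: "P *v (- u) = - (P *v u)"
    using matrix_vector_mult_diff_distrib[of P 0 u] by simp
  show "ip P (u + v) w = ip P u w + ip P v w" "ip P (u - v) w = ip P u w - ip P v w"
    "ip P (- u) w = - ip P u w" "ip P (c *\<^sub>R u) w = c * ip P u w"
    "ip P w (u + v) = ip P w u + ip P w v" "ip P w (u - v) = ip P w u - ip P w v"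
    "ip P w (- u) = - ip P w u" "ip P w (c *\<^sub>R u) = c * ip P w u"
    by (simp_all add: ip_def inner_simps matrix_vector_right_distrib
        matrix_vector_mult_diff_distrib matrix_vector_mult_scaleR neg)
qed

lemma pos_def_sym: "pos_def P \<Longrightarrow> ip P x y = ip P y x"
  by (simp add: pos_def_def)

lemma pos_def_pos: "pos_def P \<Longrightarrow> x \<noteq> 0 \<Longrightarrow> ip P x x > 0"
  by (simp add: pos_def_def)

lemma pos_def_nonneg: "pos_def P \<Longrightarrow> ip P x x \<ge> 0"
  by (cases "x = 0") (auto simp: pos_def_def ip_def less_imp_le)

lemma pos_def_Cauchy_Schwarz:
  assumes P: "pos_def P"
  shows "(ip P u v)\<^sup>2 \<le> ip P u u * ip P v v"
proof (cases "v = 0")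
  case True
  then show ?thesis by (simp add: ip_def)
next
  case False
  have vv: "ip P v v > 0" using pos_def_pos[OF P False] .
  define t where "t = ip P u v / ip P v v"
  \<comment> \<open>The residual of projecting \<open>u\<close> on \<open>v\<close> has nonnegative square length.\<close>
  have "0 \<le> ip P (u - t *\<^sub>R v) (u - t *\<^sub>R v)" by (rule pos_def_nonneg[OF P])
  also have "\<dots> = ip P u u - 2 * t * ip P u v + t * t * ip P v v"
    by (simp add: ip_linear pos_def_sym[OF P, of v u] algebra_simps)
  also have "\<dots> = ip P u u - (ip P u v)\<^sup>2 / ip P v v"
    using vv by (simp add: t_def field_simps power2_eq_square)
  finally show ?thesis using vv by (simp add: field_simps)
qed

lemma pos_def_mult_inv:
  assumes P: "pos_def P"
  shows "P *v (matrix_inv P *v x) = x"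
proof -
  have "x = 0" if "P *v x = 0" for x
    using pos_def_pos[OF P, of x] that by (auto simp: ip_def)
  then obtain B where "B ** P = mat 1"
    using matrix_left_invertible_ker[of P] by blast
  then have "invertible P"
    using matrix_left_right_inverse invertible_def by blast
  then have "P ** matrix_inv P = mat 1"
    unfolding invertible_def matrix_inv_def by (rule someI2_ex) simp
  then show ?thesis by (simp add: matrix_vector_mul_assoc)
qed

section \<open>Positive definiteness of the preconditioner\<close>

lemma inner_diag_mat: "x \<bullet> (diag_mat v *v y) = (\<Sum>i\<in>UNIV. v $ i * x $ i * y $ i)"
  by (simp add: inner_vec_def diag_mat_def matrix_vector_mult_def if_distrib if_distribR
      sum.delta cong: if_cong) (simp add: mult.commute mult.left_commute)

lemma ip_congruence: "ip (transpose J ** D ** J) x y = ip D (J *v x) (J *v y)"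
proof -
  have "x \<bullet> (transpose J *v w) = (J *v x) \<bullet> w" for w
    using dot_lmul_matrix[of w J x] by (simp add: inner_commute)
  then show ?thesis
    by (simp add: ip_def matrix_vector_mul_assoc[symmetric] del: transpose_matrix_vector)
qed

text \<open>The three summands of \<open>P\<close> are diagonal matrices with nonnegative entries, up to a
  congruence by \<open>J\<close>; the summand \<open>\<delta> I\<close> makes the form definite.\<close>

lemma pos_def_P_mat:
  fixes f :: "'m::finite \<Rightarrow> real ^ 'n::finite \<Rightarrow> real"
  assumes "\<delta> > 0" and "\<And>i. 0 \<le> L i"
  shows "pos_def (P_mat \<tau> \<delta> L f z)"
proof -
  let ?J = "J_mat f z" and ?D = "D_mat \<tau> f z"
  have eq: "ip (P_mat \<tau> \<delta> L f z) x y =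
      \<delta> * (x \<bullet> y) + (\<Sum>i\<in>UNIV. L i) * ip Pi_x x y + (1/2) * ip ?D (?J *v x) (?J *v y)" for x y
    by (simp add: P_mat_def ip_congruence[symmetric])
       (simp add: ip_def matrix_vector_mult_add_rdistrib inner_simps
         scaleR_matrix_vector_assoc[symmetric])
  have sym: "ip ?D u v = ip ?D v u" "ip Pi_x x y = ip Pi_x y x" for u v x y
    by (simp_all add: ip_def D_mat_def Pi_x_def inner_diag_mat mult_ac)
  have D: "ip ?D u u \<ge> 0" for u
    by (auto simp: ip_def D_mat_def inner_diag_mat omega_def mult.assoc intro!: sum_nonneg)
  have Pi: "ip Pi_x x x \<ge> 0" for x :: "real ^ 'n option"
    by (auto simp: ip_def Pi_x_def inner_diag_mat mult.assoc intro!: sum_nonneg split: option.split)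
  have "ip (P_mat \<tau> \<delta> L f z) x x > 0" if "x \<noteq> 0" for x
    unfolding eq using that assms D Pi
    by (intro add_pos_nonneg mult_pos_pos mult_nonneg_nonneg sum_nonneg) auto
  moreover have "ip (P_mat \<tau> \<delta> L f z) x y = ip (P_mat \<tau> \<delta> L f z) y x" for x y
    unfolding eq by (simp add: inner_commute sym(1)[of "?J *v x"] sym(2)[of x])
  ultimately show ?thesis by (simp add: pos_def_def)
qed

section \<open>The norm of a rotation-like matrix with one enlarged diagonal entry\<close>

text \<open>The left-hand side is the quadratic form of \<open>\<Gamma> I - M\<^sup>T M\<close> from the introduction, with
  \<open>\<Gamma> = G\<^sup>2\<close>. Multiplying it by \<open>E\<close> and completing the square in \<open>y\<close> leaves \<open>a\<^sup>2\<close> times the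
  determinant, which factors as
  \<open>(E - (G + 1) \<mu>) (E + (G - 1) \<mu>)\<close>.\<close>

lemma shifted_rotation_form_nonneg:
  fixes E G \<mu> w a y :: real
  assumes G: "1 \<le> G" and mu: "0 \<le> \<mu>" "(G + 1) * \<mu> \<le> E" and E: "E = G\<^sup>2 - 1 - w\<^sup>2"
  shows "0 \<le> E * y\<^sup>2 + (E - 2 * \<mu> - \<mu>\<^sup>2) * a\<^sup>2 + 2 * w * \<mu> * a * y"
proof (cases "E = 0")
  case True
  then have "(G + 1) * \<mu> = 0" using G mu by (intro antisym) auto
  then have "\<mu> = 0" using G by auto
  then show ?thesis using True by simp
next
  case False
  have "E > 0" using False G mu by (smt (verit) mult_nonneg_nonneg)
  have w2: "w\<^sup>2 = G\<^sup>2 - 1 - E" using E by simp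
  have "E * (E * y\<^sup>2 + (E - 2 * \<mu> - \<mu>\<^sup>2) * a\<^sup>2 + 2 * w * \<mu> * a * y)
      = (E * y + w * \<mu> * a)\<^sup>2 + (E * (E - 2 * \<mu> - \<mu>\<^sup>2) - \<mu>\<^sup>2 * w\<^sup>2) * a\<^sup>2"
    by (simp add: power2_eq_square algebra_simps)
  also have "\<dots> = (E * y + w * \<mu> * a)\<^sup>2 + (E - (G + 1) * \<mu>) * (E + (G - 1) * \<mu>) * a\<^sup>2"
    unfolding w2 by (simp add: power2_eq_square algebra_simps)
  also have "\<dots> \<ge> 0"
    using G mu \<open>E > 0\<close> by (intro add_nonneg_nonneg mult_nonneg_nonneg) auto
  finally show ?thesis using \<open>E > 0\<close> by (simp add: zero_le_mult_iff)
qed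

section \<open>The direction in normalised form\<close>

text \<open>Here \<open>\<kappa>\<close> is \<open>1 / (\<theta> + \<chi>)\<close>. The coordinates of \<open>p\<close> in the plane of \<open>\<sigma>\<close> and \<open>\<beta>\<close> are
  \<open>a = \<langle>p, \<sigma>\<rangle>\<close> and \<open>y = \<langle>p, \<eta>\<rangle>\<close>, where \<open>\<beta> = \<chi> \<sigma> + r \<eta>\<close> with
  \<open>r = \<surd>(1 - \<chi>\<^sup>2)\<close>, and the quarter turn carries the factor \<open>w = \<kappa> r\<close>. The vector \<open>\<eta>\<close> does not
  exist if \<open>\<sigma>\<close> and \<open>\<beta>\<close> are parallel; the number \<open>e = r y = \<langle>p, \<beta> - \<chi> \<sigma>\<rangle>\<close> always does, so the
  square length of the direction is computed from \<open>a\<close> and \<open>e\<close>.\<close>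

lemma unit_direction_bound:
  assumes P: "pos_def P" and unit: "ip P \<sigma> \<sigma> = 1" "ip P \<beta> \<beta> = 1" and x: "x = ip P \<sigma> \<beta>"
    and G: "1 \<le> G" and mu: "0 \<le> \<mu>" "(G + 1) * \<mu> \<le> G\<^sup>2 - 1 - \<kappa>\<^sup>2 * (1 - x\<^sup>2)"
    and d: "d = - p + (\<kappa> * ip P p \<beta> - \<mu> * ip P p \<sigma>) *\<^sub>R \<sigma> - (\<kappa> * ip P p \<sigma>) *\<^sub>R \<beta>"
  shows "ip P d d \<le> G\<^sup>2 * ip P p p"
proof -
  define a where "a = ip P p \<sigma>"
  define e where "e = ip P p (\<beta> - x *\<^sub>R \<sigma>)"
  define r where "r = sqrt (1 - x\<^sup>2)"
  define y where "y = e / r"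
  have pb: "ip P p \<beta> = e + x * a" by (simp add: e_def a_def ip_linear)
  have x2: "x\<^sup>2 \<le> 1"
    using pos_def_Cauchy_Schwarz[OF P, of \<sigma> \<beta>] unit by (simp add: x)
  have r2: "r\<^sup>2 = 1 - x\<^sup>2" using x2 by (simp add: r_def)
  \<comment> \<open>Bessel's inequality, as Cauchy-Schwarz for the components orthogonal to \<open>\<sigma>\<close>.\<close>
  have "(ip P (p - a *\<^sub>R \<sigma>) (\<beta> - x *\<^sub>R \<sigma>))\<^sup>2
      \<le> ip P (p - a *\<^sub>R \<sigma>) (p - a *\<^sub>R \<sigma>) * ip P (\<beta> - x *\<^sub>R \<sigma>) (\<beta> - x *\<^sub>R \<sigma>)"
    by (rule pos_def_Cauchy_Schwarz[OF P])
  also have "ip P (p - a *\<^sub>R \<sigma>) (\<beta> - x *\<^sub>R \<sigma>) = e"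
    by (simp add: e_def a_def ip_linear unit x algebra_simps)
  also have "ip P (p - a *\<^sub>R \<sigma>) (p - a *\<^sub>R \<sigma>) = ip P p p - a\<^sup>2"
    by (simp add: a_def ip_linear unit pos_def_sym[OF P, of \<sigma> p] power2_eq_square algebra_simps)
  also have "ip P (\<beta> - x *\<^sub>R \<sigma>) (\<beta> - x *\<^sub>R \<sigma>) = r\<^sup>2"
    unfolding r2
    by (simp add: ip_linear unit pos_def_sym[OF P, of \<beta> \<sigma>] x power2_eq_square algebra_simps)
  finally have bessel: "e\<^sup>2 \<le> (ip P p p - a\<^sup>2) * r\<^sup>2" .
  \<comment> \<open>In the parallel case \<open>r = 0\<close>, Bessel's inequality gives \<open>e = 0\<close>, and the value \<open>y = 0\<close>
    of the division by zero is the right one.\<close>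
  have e: "e = r * y" using bessel by (cases "r = 0") (auto simp: y_def)
  have "a\<^sup>2 \<le> ip P p p"
    using pos_def_Cauchy_Schwarz[OF P, of p \<sigma>] unit by (simp add: a_def)
  then have ay: "a\<^sup>2 + y\<^sup>2 \<le> ip P p p"
    using bessel by (cases "r = 0") (auto simp: y_def power_divide divide_simps algebra_simps)
  have w2: "(\<kappa> * r)\<^sup>2 = \<kappa>\<^sup>2 * (1 - x\<^sup>2)" by (simp add: power_mult_distrib r2)
  have "ip P d d = ip P p p + \<kappa>\<^sup>2 * (e\<^sup>2 + (1 - x\<^sup>2) * a\<^sup>2) + (2 * \<mu> + \<mu>\<^sup>2) * a\<^sup>2
      - 2 * \<kappa> * \<mu> * a * e"
    unfolding d
    by (simp add: ip_linear unit pos_def_sym[OF P, of \<sigma> p] pos_def_sym[OF P, of \<beta> p]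
        pos_def_sym[OF P, of \<beta> \<sigma>] x[symmetric] a_def[symmetric] pb power2_eq_square algebra_simps)
  also have "\<dots> = ip P p p + (\<kappa> * r)\<^sup>2 * (a\<^sup>2 + y\<^sup>2) + (2 * \<mu> + \<mu>\<^sup>2) * a\<^sup>2
      - 2 * (\<kappa> * r) * \<mu> * a * y"
    unfolding e power_mult_distrib r2 by (simp add: power2_eq_square algebra_simps)
  also have "\<dots> \<le> ip P p p + (G\<^sup>2 - 1) * (a\<^sup>2 + y\<^sup>2)"
    using shifted_rotation_form_nonneg[OF G mu(1), of "G\<^sup>2 - 1 - (\<kappa> * r)\<^sup>2" "\<kappa> * r" y a] mu(2)
    unfolding w2[symmetric] by (simp add: algebra_simps)
  also have "\<dots> \<le> ip P p p + (G\<^sup>2 - 1) * ip P p p"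
    using ay G by (intro add_left_mono mult_left_mono) auto
  finally show ?thesis by (simp add: algebra_simps)
qed

lemma chi_abs_le_one:
  assumes "pos_def P"
  shows "\<bar>chi P s b\<bar> \<le> 1"
proof -
  define q where "q = matrix_inv P *v b"
  have b: "b = P *v q" by (simp add: q_def pos_def_mult_inv[OF assms])
  have "C_val P s = ip P s s" "B_val P b = ip P q q" "s \<bullet> b = ip P s q"
    by (auto simp: C_val_def B_val_def ip_def q_def[symmetric] b[symmetric] inner_commute)
  moreover have "\<bar>ip P s q\<bar> \<le> sqrt (ip P s s * ip P q q)"
    using real_sqrt_le_mono[OF pos_def_Cauchy_Schwarz[OF assms, of s q]] by simp
  ultimately show ?thesis
    using divide_right_mono[of "\<bar>ip P s q\<bar>" "sqrt (ip P s s * ip P q q)"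
        "sqrt (ip P s s * ip P q q)"] pos_def_nonneg[OF assms, of s] pos_def_nonneg[OF assms, of q]
    by (auto simp: chi_def abs_divide divide_le_eq_1)
qed

text \<open>The rescaling turns \<open>den\<close> into \<open>\<surd>(C B) (\<theta> + \<chi>)\<close>, and the factor \<open>\<surd>(C B)\<close> is absorbed by
  the two normalised vectors.\<close>

lemma enhanced_dir_normalised:
  assumes P: "pos_def P" and "s \<noteq> 0" "b \<noteq> 0" and "p = matrix_inv P *v g"
  obtains \<sigma> \<beta> where "ip P \<sigma> \<sigma> = 1" "ip P \<beta> \<beta> = 1" "ip P \<sigma> \<beta> = chi P s b"
    "enhanced_dir \<theta> P s b g \<mu> = - p
      + (inverse (\<theta> + chi P s b) * ip P p \<beta> - \<mu> * ip P p \<sigma>) *\<^sub>R \<sigma>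
      - (inverse (\<theta> + chi P s b) * ip P p \<sigma>) *\<^sub>R \<beta>"
proof -
  define q where "q = matrix_inv P *v b"
  have b: "b = P *v q" by (simp add: q_def pos_def_mult_inv[OF P])
  have g: "g = P *v p" by (simp add: assms pos_def_mult_inv[OF P])
  have "q \<noteq> 0" using b \<open>b \<noteq> 0\<close> by auto
  define c where "c = sqrt (C_val P s)"
  define h where "h = sqrt (B_val P b)"
  have C: "C_val P s = ip P s s" and B: "B_val P b = ip P q q" and sb: "s \<bullet> b = ip P s q"
    by (auto simp: C_val_def B_val_def ip_def q_def[symmetric] b[symmetric] inner_commute)
  have gs: "g \<bullet> s = ip P p s" and gq: "g \<bullet> q = ip P p q"
    using pos_def_sym[OF P, of p] by (auto simp: g ip_def inner_commute)
  have pos: "c > 0" "h > 0"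
    using pos_def_pos[OF P] \<open>s \<noteq> 0\<close> \<open>q \<noteq> 0\<close> by (auto simp: c_def h_def C B)
  have c2: "C_val P s = c * c" and h2: "B_val P b = h * h"
    using pos_def_nonneg[OF P] by (simp_all add: c_def h_def C B)
  have root: "sqrt (C_val P s * B_val P b) = c * h"
    by (simp add: c_def h_def real_sqrt_mult)
  have chi: "chi P s b = ip P s q / (c * h)" by (simp add: chi_def root sb)
  have den: "den \<theta> P s b = (c * h) * (\<theta> + chi P s b)"
    using pos unfolding den_def root sb chi by (simp add: field_simps)
  show thesis
  proof (rule that)
    show "ip P ((1 / c) *\<^sub>R s) ((1 / c) *\<^sub>R s) = 1"
      using c2 C pos by (simp add: ip_linear)
    show "ip P ((1 / h) *\<^sub>R q) ((1 / h) *\<^sub>R q) = 1"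
      using h2 B pos by (simp add: ip_linear)
    show "ip P ((1 / c) *\<^sub>R s) ((1 / h) *\<^sub>R q) = chi P s b"
      by (simp add: ip_linear chi)
    show "enhanced_dir \<theta> P s b g \<mu> = - p
      + (inverse (\<theta> + chi P s b) * ip P p ((1 / h) *\<^sub>R q) - \<mu> * ip P p ((1 / c) *\<^sub>R s))
          *\<^sub>R ((1 / c) *\<^sub>R s)
      - (inverse (\<theta> + chi P s b) * ip P p ((1 / c) *\<^sub>R s)) *\<^sub>R ((1 / h) *\<^sub>R q)"
      unfolding enhanced_dir_def q_def[symmetric] assms(4)[symmetric] gs gq den c2 ip_linear
      by (simp add: divide_inverse scaleR_diff_left right_diff_distrib mult_ac)
  qed
qed

section \<open>The admissible range of the parameter\<close>

text \<open>The interval of admissible \<open>\<mu>\<close> is nonempty since \<open>1 / (\<theta>\<^sup>2 - 1)\<close>, which is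
  \<open>\<Gamma>\<^sub>0 - 1\<close>, is the maximum of \<open>(1 - x\<^sup>2) / (\<theta> + x)\<^sup>2\<close> over \<open>\<bar>x\<bar> \<le> 1\<close>, attained at
  \<open>x = - 1 / \<theta>\<close>.\<close>

lemma mu_star_nonneg:
  assumes P: "pos_def P" and th: "\<theta> > 1"
  shows "0 \<le> mu_star \<theta> P s b"
proof -
  define x where "x = chi P s b"
  have x: "\<bar>x\<bar> \<le> 1" unfolding x_def by (rule chi_abs_le_one[OF P])
  have t2: "\<theta>\<^sup>2 > 1" using th by (simp add: one_less_power)
  have pos: "(\<theta> + x)\<^sup>2 > 0" using x th by auto
  have "(\<theta> + x)\<^sup>2 - (1 - x\<^sup>2) * (\<theta>\<^sup>2 - 1) = (1 + \<theta> * x)\<^sup>2"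
    by (simp add: power2_eq_square algebra_simps)
  then have "(1 - x\<^sup>2) * (\<theta>\<^sup>2 - 1) \<le> (\<theta> + x)\<^sup>2"
    by (metis diff_ge_0_iff_ge zero_le_power2)
  then have "(1 - x\<^sup>2) / (\<theta> + x)\<^sup>2 \<le> 1 / (\<theta>\<^sup>2 - 1)"
    using pos t2 by (simp add: divide_simps)
  also have "\<dots> = Gamma0 \<theta> - 1" using t2 by (simp add: Gamma0_def field_simps)
  finally have "varpi_sq \<theta> P s b \<le> Gamma0 \<theta> - 1" by (simp add: varpi_sq_def x_def)
  moreover have "Gamma0 \<theta> \<ge> 0" using t2 by (simp add: Gamma0_def)
  ultimately show ?thesis by (simp add: mu_star_def)
qed

lemma enhanced_dir_bound:
  assumes P: "pos_def P" and sb: "s \<noteq> 0" "b \<noteq> 0" and th: "\<theta> > 1"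
    and mu: "0 \<le> \<mu>" "\<mu> \<le> mu_star \<theta> P s b"
  shows "enhanced_dir \<theta> P s b g \<mu> \<bullet> (P *v enhanced_dir \<theta> P s b g \<mu>)
    \<le> Gamma0 \<theta> * (g \<bullet> (matrix_inv P *v g))"
proof -
  define p where "p = matrix_inv P *v g"
  define G where "G = sqrt (Gamma0 \<theta>)"
  have t2: "\<theta>\<^sup>2 > 1" using th by (simp add: one_less_power)
  then have Gam: "Gamma0 \<theta> \<ge> 1" by (simp add: Gamma0_def)
  then have G: "1 \<le> G" and G2: "G\<^sup>2 = Gamma0 \<theta>" by (simp_all add: G_def)
  obtain \<sigma> \<beta> where n: "ip P \<sigma> \<sigma> = 1" "ip P \<beta> \<beta> = 1" "ip P \<sigma> \<beta> = chi P s b"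
    and d: "enhanced_dir \<theta> P s b g \<mu> = - p
      + (inverse (\<theta> + chi P s b) * ip P p \<beta> - \<mu> * ip P p \<sigma>) *\<^sub>R \<sigma>
      - (inverse (\<theta> + chi P s b) * ip P p \<sigma>) *\<^sub>R \<beta>"
    using enhanced_dir_normalised[OF P sb p_def] by metis
  have "varpi_sq \<theta> P s b = (inverse (\<theta> + chi P s b))\<^sup>2 * (1 - (chi P s b)\<^sup>2)"
    by (simp add: varpi_sq_def power_inverse divide_inverse mult.commute)
  then have "(G + 1) * \<mu> \<le> G\<^sup>2 - 1 - (inverse (\<theta> + chi P s b))\<^sup>2 * (1 - (chi P s b)\<^sup>2)"
    using mu(2) G unfolding mu_star_def G_def[symmetric] G2
    by (simp add: le_divide_eq mult.commute)
  then have "ip P (enhanced_dir \<theta> P s b g \<mu>) (enhanced_dir \<theta> P s b g \<mu>) \<le> G\<^sup>2 * ip P p p"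
    by (rule unit_direction_bound[OF P n(1,2) n(3)[symmetric] G mu(1) _ d])
  moreover have "ip P p p = g \<bullet> (matrix_inv P *v g)"
    by (simp add: ip_def p_def pos_def_mult_inv[OF P] inner_commute)
  ultimately show ?thesis by (simp add: ip_def G2)
qed

theorem corollary5p3:
  fixes f :: "'m::finite \<Rightarrow> real ^ 'n::finite \<Rightarrow> real"
    and L :: "'m \<Rightarrow> real"
    and \<tau> \<delta> \<theta> :: real
    and z_prev z s b g :: "real ^ 'n option"
    and P :: "real ^ 'n option ^ 'n option"
  assumes "\<And>i x. f i differentiable (at x)"
    and "\<And>i. continuous_on UNIV (gradient (f i))"
    and "\<And>i. 0 \<le> L i"
    and "\<And>i. (L i)-lipschitz_on UNIV (gradient (f i))"
    and "\<tau> > 0" and "\<delta> > 0" and "\<theta> > 1"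
    and "z_prev \<noteq> z" and "b \<noteq> 0"
    and "s = z - z_prev"
    and "g = gradient (Phi \<tau> f) z"
    and "P = P_mat \<tau> \<delta> L f z"
  shows "(\<forall>\<mu>. 0 \<le> \<mu> \<and> \<mu> \<le> mu_star \<theta> P s b \<longrightarrow>
            enhanced_dir \<theta> P s b g \<mu> \<bullet> (P *v enhanced_dir \<theta> P s b g \<mu>)
              \<le> Gamma0 \<theta> * (g \<bullet> (matrix_inv P *v g)))
       \<and> (\<forall>\<xi>. 0 \<le> \<xi> \<and> \<xi> \<le> 1 \<longrightarrow>
            0 \<le> \<xi> * mu_star \<theta> P s b \<and> \<xi> * mu_star \<theta> P s b \<le> mu_star \<theta> P s b
            \<and> enhanced_dir \<theta> P s b g (\<xi> * mu_star \<theta> P s b)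
                \<bullet> (P *v enhanced_dir \<theta> P s b g (\<xi> * mu_star \<theta> P s b))
              \<le> Gamma0 \<theta> * (g \<bullet> (matrix_inv P *v g)))"
proof -
  have P: "pos_def P" unfolding assms(12) by (rule pos_def_P_mat) (use assms in auto)
  have s: "s \<noteq> 0" using assms by auto
  note bound = enhanced_dir_bound[OF P s \<open>b \<noteq> 0\<close> \<open>\<theta> > 1\<close>]
  have star: "0 \<le> mu_star \<theta> P s b" by (rule mu_star_nonneg[OF P \<open>\<theta> > 1\<close>])
  have "0 \<le> \<xi> * mu_star \<theta> P s b \<and> \<xi> * mu_star \<theta> P s b \<le> mu_star \<theta> P s b"
    if "0 \<le> \<xi>" "\<xi> \<le> 1" for \<xi>
    using that star by (simp add: mult_left_le_one_le)
  then show ?thesis using bound by blast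
qed

end
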